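(* For every integer $n\ge 1$, $|\mathcal{S}_n(32;\,1\to 2)| = B_n$, where $B_n$ is the $n$-th Bell number.
   Context: $[n]=\{1,\dots,n\}$, and $\mathcal{S}_n$ is the set of permutations $\pi=\pi_1\pi_2\cdots\pi_n$ of $[n]$ in one-line notation. The permutation $\hat\pi$: for $\pi\in\mathcal{S}_n$, $\hat\pi\in\mathcal{S}_n$ is the permutation whose cycle form is obtained from the word $\pi_1\cdots\pi_n$ by inserting a left parenthesis before each left-to-right maximum (an entry larger than all entries to its left) and a right parenthesis immediately before the next left-to-right maximum, or at the end of the word. A cycle $(c_1,c_2,\dots,c_s)$ means $c_1\mapsto c_2\mapsto\cdots\mapsto c_s\mapsto c_1$. Example: if $\pi=2537164$ then $\hat\pi=(2)(53)(7164)$. Arrow patterns: an arrow pattern of size $k$ is a pair $(\nu;H)$ where $\nu=\nu_1\cdots\nu_m$ is a word of distinct positive integers, $H$ is a collection of arrows $b_i\to c_i$, and the set of all integers appearing in $\nu$ or $H$ is $[k]$. A permutation $\pi\in\mathcal{S}_n$ contains $(\nu;H)$ if there are a set $X=\{x_1<x_2<\cdots<x_k\}\subseteq[n]$ and indices $t_1<\cdots<t_m$ such that $\pi_{t_1}\pi_{t_2}\cdots\pi_{t_m}=x_{\nu_1}x_{\nu_2}\cdots x_{\nu_m}$ and $\hat\pi(x_{b_i})=x_{c_i}$ for every arrow $b_i\to c_i$ in $H$. Otherwise $\pi$ avoids $(\nu;H)$. $\mathcal{S}_n(\nu;H)$ is the set of permutations in $\mathcal{S}_n$ avoiding $(\nu;H)$.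 The Bell number $B_n$ is the number of set partitions of $[n]$. *)

theory Defs
  imports "HOL-Combinatorics.Combinatorics" "HOL-Library.Disjoint_Sets"
begin

text \<open>
  Permutations of \<open>[n]\<close> are represented by their one-line notation, i.e. by the lists in
  \<^term>\<open>permutations_of_set {1..n}\<close>. Positions in a list are counted from \<open>0\<close>, while the
  letters of permutations and of patterns start from \<open>1\<close>.
\<close>

definition left_to_right_max :: "nat list \<Rightarrow> nat \<Rightarrow> bool" where
  "left_to_right_max w i \<longleftrightarrow> i < length w \<and> (\<forall>j<i. w ! j < w ! i)"

text \<open>
  The first letter of a word is a left-to-right maximum, and the left-to-right maximum following
  a left-to-right maximum \<open>x\<close> is the first later letter exceeding \<open>x\<close>. Hence the following
  function cuts a word immediately before each of its left-to-right maxima; see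
  \<open>concat_cycle_form\<close> and \<open>cycle_form_starts\<close> below.
\<close>

function cycle_form :: "nat list \<Rightarrow> nat list list" where
  "cycle_form [] = []"
| "cycle_form (x # xs) =
     (x # takeWhile (\<lambda>y. y \<le> x) xs) # cycle_form (dropWhile (\<lambda>y. y \<le> x) xs)"
  by pat_completeness auto
termination
  by (relation "measure length") (auto simp: less_Suc_eq_le length_dropWhile_le)

definition hat :: "nat list \<Rightarrow> nat \<Rightarrow> nat" where
  "hat w = foldr (\<circ>) (map cycle_of_list (cycle_form w)) id"

type_synonym pattern = "nat list \<times> (nat \<times> nat) set"

definition letters :: "pattern \<Rightarrow> nat set" where
  "letters p = set (fst p) \<union> fst ` snd p \<union> snd ` snd p"

definition arrow_pattern :: "nat \<Rightarrow> pattern \<Rightarrow> bool" where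
  "arrow_pattern k p \<longleftrightarrow> distinct (fst p) \<and> letters p = {1..k}"

text \<open>
  The size \<open>k\<close> of an arrow pattern is the number of its letters. The set
  \<open>X = {x\<^sub>1 < \<dots> < x\<^sub>k}\<close> is given by its increasing enumeration \<open>x\<close>.
\<close>

definition contains :: "nat list \<Rightarrow> pattern \<Rightarrow> bool" where
  "contains w p \<longleftrightarrow>
     (\<exists>x t. strict_mono_on {1..card (letters p)} x \<and>
            x ` {1..card (letters p)} \<subseteq> {1..length w} \<and>
            strict_mono_on {..<length (fst p)} t \<and>
            t ` {..<length (fst p)} \<subseteq> {..<length w} \<and>
            (\<forall>i<length (fst p). w ! t i = x (fst p ! i)) \<and>
            (\<forall>(b, c) \<in> snd p. hat w (x b) = x c))"

definition avoiders :: "nat \<Rightarrow> pattern \<Rightarrow> nat list set" where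
  "avoiders n p = {w \<in> permutations_of_set {1..n}. \<not> contains w p}"

definition bell_number :: "nat \<Rightarrow> nat" where
  "bell_number n = card {P. partition_on {1..n} P}"

lemma concat_cycle_form: "concat (cycle_form w) = w"
  by (induction w rule: cycle_form.induct) auto

lemma Nil_notin_cycle_form: "[] \<notin> set (cycle_form w)"
  by (induction w rule: cycle_form.induct) auto

lemma left_to_right_max_append:
  assumes "x \<in> set u" "\<forall>y\<in>set u. y \<le> x" "v = [] \<or> x < hd v"
  shows "{i. left_to_right_max (u @ v) i} =
           {i. left_to_right_max u i} \<union> (+) (length u) ` {i. left_to_right_max v i}"
proof (cases v)
  case Nil
  then show ?thesis by (auto simp: left_to_right_max_def)
next
  case (Cons a v')
  have gt: "\<forall>j<length u. u ! j < v ! i" if "left_to_right_max v i" for i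
  proof -
    have "a \<le> v ! i"
      using that Cons by (cases i) (auto simp: left_to_right_max_def less_imp_le)
    then show ?thesis using assms Cons by (fastforce dest: nth_mem)
  qed
  show ?thesis
  proof (intro set_eqI iffI)
    fix i assume i: "i \<in> {i. left_to_right_max (u @ v) i}"
    show "i \<in> {i. left_to_right_max u i} \<union> (+) (length u) ` {i. left_to_right_max v i}"
    proof (cases "i < length u")
      case True
      then have "\<And>j. j < i \<Longrightarrow> u ! j < u ! i"
        using i by (auto simp: left_to_right_max_def nth_append split: if_splits)
      then show ?thesis using True by (auto simp: left_to_right_max_def)
    next
      case False
      have "v ! j < v ! (i - length u)" if "j < i - length u" for j
      proof -
        have "length u + j < i" using that by simp
        then have "(u @ v) ! (length u + j) < (u @ v) ! i"
          using i unfolding left_to_right_max_def by blast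
        then show ?thesis using False by (simp add: nth_append)
      qed
      then have "left_to_right_max v (i - length u)"
        using i False by (auto simp: left_to_right_max_def)
      then show ?thesis using False by (auto intro!: image_eqI[of _ _ "i - length u"])
    qed
  next
    fix i assume "i \<in> {i. left_to_right_max u i} \<union> (+) (length u) ` {i. left_to_right_max v i}"
    then show "i \<in> {i. left_to_right_max (u @ v) i}"
    proof
      assume "i \<in> {i. left_to_right_max u i}"
      then show ?thesis by (auto simp: left_to_right_max_def nth_append)
    next
      assume "i \<in> (+) (length u) ` {i. left_to_right_max v i}"
      then obtain k where k: "left_to_right_max v k" "i = length u + k" by auto
      have "(u @ v) ! j < v ! k" if "j < length u + k" for j
        using that k gt[OF k(1)]
        by (cases "j < length u") (auto simp: left_to_right_max_def nth_append)
      then show ?thesis using k by (auto simp: left_to_right_max_def nth_append)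
    qed
  qed
qed

lemma cycle_form_starts:
  "{length (concat (take m (cycle_form w))) |m. m < length (cycle_form w)}
     = {i. left_to_right_max w i}"
proof (induction w rule: cycle_form.induct)
  case 1
  then show ?case by (simp add: left_to_right_max_def)
next
  case (2 x xs)
  let ?u = "x # takeWhile (\<lambda>y. y \<le> x) xs" and ?v = "dropWhile (\<lambda>y. y \<le> x) xs"
  have "{i. left_to_right_max (?u @ ?v) i} =
      {i. left_to_right_max ?u i} \<union> (+) (length ?u) ` {i. left_to_right_max ?v i}"
  proof (rule left_to_right_max_append[of x])
    show "\<forall>y\<in>set ?u. y \<le> x" by (auto dest: set_takeWhileD)
    show "?v = [] \<or> x < hd ?v"
      using hd_dropWhile[of "\<lambda>y. y \<le> x" xs] by (metis not_le)
  qed simp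
  moreover have "{i. left_to_right_max ?u i} = {0}"
  proof -
    have "\<not> left_to_right_max ?u (Suc i)" for i
    proof
      assume "left_to_right_max ?u (Suc i)"
      then have "i < length (takeWhile (\<lambda>y. y \<le> x) xs)" "x < takeWhile (\<lambda>y. y \<le> x) xs ! i"
        by (auto simp: left_to_right_max_def)
      then show False by (meson leD nth_mem set_takeWhileD)
    qed
    moreover have "left_to_right_max ?u 0" by (simp add: left_to_right_max_def)
    ultimately show ?thesis by (auto simp: gr0_conv_Suc) (metis not0_implies_Suc)
  qed
  moreover have "{length (concat (take m (?u # cycle_form ?v))) |m. m < length (?u # cycle_form ?v)}
      = insert 0 ((+) (length ?u) `
          {length (concat (take m (cycle_form ?v))) |m. m < length (cycle_form ?v)})"
    (is "?L = ?R")
  proof (intro set_eqI iffI)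
    fix i assume "i \<in> ?L"
    then obtain m where "m < length (?u # cycle_form ?v)"
      "i = length (concat (take m (?u # cycle_form ?v)))" by blast
    then show "i \<in> ?R" by (cases m) auto
  next
    fix i assume "i \<in> ?R"
    then consider "i = 0" | m where "m < length (cycle_form ?v)"
      "i = length ?u + length (concat (take m (cycle_form ?v)))" by blast
    then show "i \<in> ?L"
    proof cases
      case 1
      then show ?thesis by (auto intro!: exI[of _ 0])
    next
      case 2
      then show ?thesis by (auto intro!: exI[of _ "Suc m"])
    qed
  qed
  ultimately show ?case using 2 by simp
qed

lemma "cycle_form [2,5,3,7,1,6,4] = [[2],[5,3],[7,1,6,4]]"
  by simp

lemma "map (hat [2,5,3,7,1,6,4]) [2, 5,3, 7,1,6,4] = [2, 3,5, 1,6,4,7]"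
  by (simp add: hat_def transpose_def)

lemma "arrow_pattern 3 ([3,2], {(1,2)})"
  by (auto simp: arrow_pattern_def letters_def)

end

theory Submission
  imports Defs
begin

text \<open>
  An ascent \<open>a < hat \<pi> a\<close> of the hat permutation either runs between neighbouring letters of a
  cycle or closes a cycle.
  In the second case the image is a left-to-right maximum, so nothing larger precedes it; in the
  first case the maximal letter of the cycle precedes the image and is larger. Hence \<open>\<pi>\<close> avoids
  the pattern iff all its cycle words are decreasing, and then \<open>\<pi>\<close> is determined by the set
  partition formed by its cycles, which are ordered by their maxima.
\<close>

section \<open>Block lists cut at left-to-right maxima\<close>

text \<open>On lists of naturals these are exactly the values of \<open>cycle_form\<close>: by
  \<open>max_headed_cycle_form\<close> and \<open>cycle_form_concat\<close>, \<open>concat\<close>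
  and \<open>cycle_form\<close> are mutually inverse between such lists and words.\<close>

definition max_headed :: "'a::linorder list list \<Rightarrow> bool" where
  "max_headed cs \<longleftrightarrow> [] \<notin> set cs \<and> (\<forall>c\<in>set cs. \<forall>y\<in>set c. y \<le> hd c) \<and>
     sorted_wrt (\<lambda>c d. hd c < hd d) cs"

lemma max_headed_Cons:
  "max_headed (c # cs) \<longleftrightarrow> c \<noteq> [] \<and> (\<forall>y\<in>set c. y \<le> hd c) \<and> (\<forall>d\<in>set cs. hd c < hd d)
     \<and> max_headed cs"
  by (auto simp: max_headed_def)

lemma hd_concat: "cs \<noteq> [] \<Longrightarrow> [] \<notin> set cs \<Longrightarrow> hd (concat cs) = hd (hd cs)"
  by (cases cs) (auto simp: hd_append)

lemma max_headed_cycle_form: "max_headed (cycle_form w)"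
proof (induction w rule: cycle_form.induct)
  case 1
  then show ?case by (simp add: max_headed_def)
next
  case (2 x xs)
  let ?v = "dropWhile (\<lambda>y. y \<le> x) xs"
  have "x < hd d" if d: "d \<in> set (cycle_form ?v)" for d
  proof (cases "cycle_form ?v")
    case Nil
    then show ?thesis using d by simp
  next
    case (Cons e es)
    \<comment> \<open>The first letter of \<open>?v\<close> is where \<open>takeWhile\<close>
      stopped, so it exceeds \<open>x\<close>. It is also the head of the first remaining block, and
      by induction the later heads are larger still.\<close>
    have "?v \<noteq> []"
    proof
      assume "?v = []"
      then have "cycle_form ?v = []" by (simp only: cycle_form.simps)
      then show False using Cons by simp
    qed
    then have "x < hd ?v" using hd_dropWhile[of "\<lambda>y. y \<le> x" xs] by (metis not_le)
    also have "hd ?v = hd e"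
      using hd_concat[of "cycle_form ?v"] Nil_notin_cycle_form[of ?v] concat_cycle_form[of ?v] Cons
      by simp
    finally show ?thesis using 2 d Cons by (auto simp: max_headed_Cons)
  qed
  then show ?case using 2 by (auto simp: max_headed_Cons dest: set_takeWhileD)
qed

text \<open>The scan started at the head of a block runs through that block, whose letters do not
  exceed the head, and stops at the next head, which does.\<close>

lemma cycle_form_concat:
  assumes "max_headed cs"
  shows "cycle_form (concat cs) = cs"
  using assms
proof (induction cs)
  case (Cons c cs)
  obtain x xs where c: "c = x # xs" using Cons.prems by (cases c) (auto simp: max_headed_Cons)
  have le: "\<And>y. y \<in> set xs \<Longrightarrow> y \<le> x" using Cons.prems c by (auto simp: max_headed_Cons)
  have rest: "takeWhile (\<lambda>y. y \<le> x) (concat cs) = [] \<and> dropWhile (\<lambda>y. y \<le> x) (concat cs) = concat cs"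
  proof (cases cs)
    case (Cons d ds)
    then have "d \<noteq> []" "x < hd d" using Cons.prems c by (auto simp: max_headed_Cons)
    then show ?thesis using Cons by (cases d) auto
  qed simp
  show ?case using Cons rest le c
    by (simp add: takeWhile_append2 dropWhile_append2 max_headed_Cons)
qed simp

lemma max_headed_earlier:
  assumes "max_headed (us @ c # vs)" "y \<in> set (concat us)"
  shows "y < hd c"
  using assms unfolding max_headed_def sorted_wrt_append by fastforce

text \<open>Increasing heads force the order of the blocks, so no information is lost in passing to
  the set of blocks.\<close>

lemma max_headed_eqI:
  assumes "max_headed cs" "max_headed ds" "set cs = set ds"
  shows "cs = ds"
proof -
  have sorted: "sorted_wrt (<) (map hd cs)" "sorted_wrt (<) (map hd ds)"
    using assms by (auto simp: max_headed_def sorted_wrt_map)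
  have "map hd cs = map hd ds"
    by (rule strict_sorted_equal) (use sorted assms in auto)
  \<comment> \<open>The union is just \<open>set cs\<close>; strictly increasing heads are distinct,
    which lifts equality of the head lists to the blocks.\<close>
  moreover have "inj_on hd (set cs \<union> set ds)"
    using strict_sorted_iff[of "map hd cs"] sorted assms by (simp add: distinct_map)
  ultimately show ?thesis by (simp add: inj_on_map_eq_map)
qed

section \<open>The hat permutation on a single block\<close>

lemma cycle_of_list_nth:
  assumes "distinct c" "i < length c"
  shows "cycle_of_list c (c ! i) = c ! (Suc i mod length c)"
proof -
  have "map (cycle_of_list c) c ! i = rotate1 c ! i"
    using cyclic_rotation[of c 1] assms by simp
  then show ?thesis using assms by (simp add: nth_rotate1)
qed

lemma foldr_cycles_outside:
  "x \<notin> set (concat cs) \<Longrightarrow> foldr (\<circ>) (map cycle_of_list cs) id x = x"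
  by (induction cs) (auto simp: id_outside_supp)

text \<open>Disjoint cycles do not interfere. The composition applies the later cycles first: if
  \<open>x\<close> lies in the first block they fix it, and otherwise its image stays in
  \<open>c\<close>, which the first cycle fixes.\<close>

lemma foldr_cycles_inside:
  assumes "distinct (concat cs)" "c \<in> set cs" "x \<in> set c"
  shows "foldr (\<circ>) (map cycle_of_list cs) id x = cycle_of_list c x"
  using assms
proof (induction cs)
  case (Cons d ds)
  show ?case
  proof (cases "x \<in> set d")
    case True
    then have "x \<notin> set (concat ds)" using Cons.prems by auto
    then have "foldr (\<circ>) (map cycle_of_list ds) id x = x" by (rule foldr_cycles_outside)
    moreover have "foldr (\<circ>) (map cycle_of_list (d # ds)) id x
      = cycle_of_list d (foldr (\<circ>) (map cycle_of_list ds) id x)" by simp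
    moreover have "c = d" using Cons.prems True by auto
    ultimately show ?thesis by metis
  next
    case False
    then have c: "c \<in> set ds" using Cons.prems by auto
    have "distinct c" using Cons.prems c by (auto simp: distinct_concat_iff)
    obtain i where "i < length c" "x = c ! i" using Cons.prems by (auto simp: in_set_conv_nth)
    moreover have "Suc i mod length c < length c"
      using \<open>i < length c\<close> by (intro mod_less_divisor) linarith
    ultimately have "cycle_of_list c x \<in> set c"
      using cycle_of_list_nth[OF \<open>distinct c\<close>] by simp
    then have "cycle_of_list c x \<notin> set d" using Cons.prems c by auto
    then show ?thesis using Cons c by (simp add: id_outside_supp)
  qed
qed simp

lemma hat_nth_block:
  assumes "distinct w" "c \<in> set (cycle_form w)" "i < length c"
  shows "hat w (c ! i) = c ! (Suc i mod length c)"
proof -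
  have d: "distinct (concat (cycle_form w))" using assms by (simp add: concat_cycle_form)
  then have "distinct c" using assms by (auto simp: distinct_concat_iff)
  then show ?thesis using foldr_cycles_inside[OF d assms(2)] assms cycle_of_list_nth
    by (simp add: hat_def)
qed

section \<open>Containment of the pattern in terms of blocks\<close>

lemma contains_32_arrow_12_iff:
  "contains w ([3, 2], {(1, 2)}) \<longleftrightarrow>
     (\<exists>a i j. 1 \<le> a \<and> a < w ! j \<and> w ! j < w ! i \<and> w ! i \<le> length w \<and> i < j \<and> j < length w
        \<and> hat w a = w ! j)"
    (is "?L \<longleftrightarrow> ?R")
proof -
  have letters: "letters ([3, 2], {(1, 2)}) = {1, 2, 3}" by (auto simp: letters_def)
  have three: "{1..card {1, 2, 3::nat}} = {1, 2, 3}" by auto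
  have two: "{..<length [3, 2::nat]} = {0, 1}" by auto
  have all2: "(\<forall>i<length [3, 2::nat]. Q i) \<longleftrightarrow> Q 0 \<and> Q 1" for Q
    by (auto simp: less_Suc_eq)
  note eqs = contains_def letters three fst_conv snd_conv two all2
  show ?thesis
  proof
    assume ?L
    then obtain x t where *: "strict_mono_on {1, 2, 3::nat} x" "x ` {1, 2, 3} \<subseteq> {1..length w}"
      "strict_mono_on {0, 1::nat} t" "t ` {0, 1} \<subseteq> {..<length w}"
      "w ! t 0 = x 3" "w ! t 1 = x 2" "hat w (x 1) = x 2"
      unfolding eqs by auto
    have "x 1 < x 2" "x 2 < x 3" "t 0 < t 1"
      using strict_mono_onD[OF *(1), of 1 2] strict_mono_onD[OF *(1), of 2 3]
        strict_mono_onD[OF *(3), of 0 1] by auto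
    then show ?R using * by (intro exI[of _ "x 1"] exI[of _ "t 0"] exI[of _ "t 1"]) auto
  next
    assume ?R
    then obtain a i j where "1 \<le> a \<and> a < w ! j \<and> w ! j < w ! i \<and> w ! i \<le> length w
      \<and> i < j \<and> j < length w \<and> hat w a = w ! j" by blast
    then show ?L unfolding eqs
      by (intro exI[of _ "\<lambda>k. if k = 1 then a else if k = 2 then w ! j else w ! i"]
          exI[of _ "\<lambda>k. if k = 0 then i else j"]) (auto simp: strict_mono_on_def)
  qed
qed

lemma contains_32_arrow_12_iff_block:
  assumes w: "w \<in> permutations_of_set {1..n}"
  shows "contains w ([3, 2], {(1, 2)}) \<longleftrightarrow> (\<exists>c\<in>set (cycle_form w). \<not> sorted_wrt (>) c)"
proof -
  have dist: "distinct w" and set_w: "set w = {1..n}" using w by (auto simp: permutations_of_set_def)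
  have len: "length w = n" using distinct_card[OF dist] set_w by simp
  show ?thesis
  proof
    assume "contains w ([3, 2], {(1, 2)})"
    then obtain a i j where *: "1 \<le> a" "a < w ! j" "w ! j < w ! i" "w ! i \<le> length w" "i < j"
      "j < length w" "hat w a = w ! j" unfolding contains_32_arrow_12_iff by blast
    have "a \<in> set (concat (cycle_form w))" using * set_w len by (simp add: concat_cycle_form)
    then obtain c where c: "c \<in> set (cycle_form w)" "a \<in> set c" by auto
    then obtain k where k: "k < length c" "a = c ! k" by (auto simp: in_set_conv_nth)
    have hat_a: "w ! j = c ! (Suc k mod length c)"
      using hat_nth_block[OF dist c(1) k(1)] k * by simp
    \<comment> \<open>Excludes that the arrow closes the cycle: then \<open>w ! j\<close> would be
      the head of its block, contradicting the larger letter \<open>w ! i\<close> to its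
      left.\<close>
    have "Suc k < length c"
    proof (rule ccontr)
      assume "\<not> Suc k < length c"
      then have "Suc k = length c" using k by simp
      then have "w ! j = c ! 0" using hat_a by simp
      then have hd: "w ! j = hd c" using k by (cases c) auto
      obtain us vs where uv: "cycle_form w = us @ c # vs" using c by (meson split_list)
      have w_eq: "w = concat us @ c @ concat vs" using concat_cycle_form[of w] uv by simp
      have "w ! length (concat us) = hd c" using k w_eq
        by (cases c) (auto simp: nth_append)
      moreover have "length (concat us) < length w"
      proof -
        have "length w = length (concat us) + (length c + length (concat vs))"
          using w_eq by (metis length_append)
        then show ?thesis using k by linarith
      qed
      \<comment> \<open>Distinctness identifies \<open>j\<close> with the starting position of the
        block \<open>c\<close>, so \<open>i < j\<close> places \<open>w ! i\<close> in an earlier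
        block, below \<open>hd c\<close>.\<close>
      ultimately have "j = length (concat us)"
        using hd * dist by (metis nth_eq_iff_index_eq)
      then have "w ! i \<in> set (concat us)" using * w_eq by (metis nth_append nth_mem)
      then have "w ! i < hd c"
        using max_headed_earlier max_headed_cycle_form[of w] uv by metis
      then show False using hd * by simp
    qed
    then have "\<not> sorted_wrt (>) c"
      using * k hat_a sorted_wrt_nth_less[of "(>)" c k "Suc k"] by auto
    then show "\<exists>c\<in>set (cycle_form w). \<not> sorted_wrt (>) c" using c by blast
  next
    assume "\<exists>c\<in>set (cycle_form w). \<not> sorted_wrt (>) c"
    then obtain c where c: "c \<in> set (cycle_form w)" "\<not> sorted_wrt (>) c" by blast
    \<comment> \<open>By transitivity of the order, failure to decrease already shows at two
      neighbours.\<close>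
    then obtain k where k: "Suc k < length c" "c ! k \<le> c ! Suc k"
      by (auto simp: sorted_wrt_iff_nth_Suc_transp transp_on_def not_less)
    obtain us vs where uv: "cycle_form w = us @ c # vs" using c by (meson split_list)
    have w_eq: "w = concat us @ c @ concat vs" using concat_cycle_form[of w] uv by simp
    have dc: "distinct c" using dist w_eq by (metis distinct_append)
    have c_sub: "set c \<subseteq> {1..n}" using set_w w_eq by auto
    let ?m = "length (concat us)"
    have nth: "w ! (?m + l) = c ! l" if "l < length c" for l
    proof -
      have "w ! (?m + l) = (c @ concat vs) ! l" using w_eq by (metis nth_append_length_plus)
      then show ?thesis using that by (simp add: nth_append)
    qed
    \<comment> \<open>The occurrence is built inside \<open>c\<close>: the head \<open>c ! 0\<close>
      plays 3, \<open>c ! Suc k\<close> plays 2 and \<open>c ! k\<close> plays 1. Distinctness makes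
      the inequalities strict.\<close>
    have "c ! l \<le> c ! 0" if "l < length c" for l
    proof -
      have "c ! l \<le> hd c" using max_headed_cycle_form[of w] c that by (auto simp: max_headed_def)
      then show ?thesis using that by (cases c) auto
    qed
    then have "c ! Suc k < c ! 0"
      using k dc by (metis le_neq_implies_less nth_eq_iff_index_eq nat.distinct(1) zero_less_Suc
          less_trans)
    moreover have "c ! k < c ! Suc k"
      using k dc nth_eq_iff_index_eq[OF dc, of k "Suc k"] by (simp add: le_neq_implies_less)
    moreover have "c ! k \<in> {1..n}" "c ! 0 \<in> {1..n}"
      using k c_sub by (meson nth_mem subsetD Suc_lessD less_trans zero_less_Suc)+
    moreover have "?m + Suc k < length w"
    proof -
      have "length w = ?m + (length c + length (concat vs))" using w_eq by (metis length_append)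
      then show ?thesis using k by simp
    qed
    moreover have "hat w (c ! k) = c ! Suc k" using hat_nth_block[OF dist c(1), of k] k by simp
    moreover have "0 < length c" using k by linarith
    then have "w ! ?m = c ! 0" using nth[of 0] by (simp only: add_0_right)
    moreover have "w ! (?m + Suc k) = c ! Suc k" using nth[of "Suc k"] k by blast
    ultimately show "contains w ([3, 2], {(1, 2)})"
      unfolding contains_32_arrow_12_iff len
      by (intro exI[of _ "c ! k"] exI[of _ "?m"] exI[of _ "?m + Suc k"]) auto
  qed
qed

section \<open>Decreasing blocks and set partitions\<close>

lemma sorted_wrt_greater_eq_rev_sorted_list:
  fixes c :: "'a::linorder list"
  assumes "sorted_wrt (>) c"
  shows "c = rev (sorted_list_of_set (set c))"
proof -
  have "sorted_wrt (<) (rev c)" using assms by (simp add: sorted_wrt_rev)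
  then have "sorted_list_of_set (set (rev c)) = rev c"
    using sorted_list_of_set.idem_if_sorted_distinct[of "rev c"] unfolding strict_sorted_iff
    by blast
  then show ?thesis by (metis rev_rev_ident set_rev)
qed

text \<open>Translates the order of blocks by heads, as in \<open>max_headed\<close>, into the order
  of parts by their maxima.\<close>

lemma hd_rev_sorted_list_of_set:
  assumes "finite A" "A \<noteq> {}"
  shows "hd (rev (sorted_list_of_set A)) = Max A"
proof -
  let ?l = "sorted_list_of_set A"
  have "?l \<noteq> []" using assms by simp
  then have "last ?l \<in> A" using assms by (metis last_in_set set_sorted_list_of_set)
  moreover have "y \<le> last ?l" if "y \<in> A" for y
  proof -
    have "sorted (butlast ?l @ [last ?l])" using \<open>?l \<noteq> []\<close> by simp
    then have "\<forall>y\<in>set (butlast ?l). y \<le> last ?l" by (simp only: sorted_append) auto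
    moreover have "set ?l = insert (last ?l) (set (butlast ?l))"
      using \<open>?l \<noteq> []\<close> by (metis append_butlast_last_id set_append list.set Un_insert_right sup_bot_right)
    moreover have "y \<in> set ?l" using that assms(1) by simp
    ultimately show ?thesis by (metis insertE order_refl)
  qed
  ultimately have "Max A = last ?l" using assms by (intro Max_eqI)
  then show ?thesis by (simp add: hd_rev)
qed

lemma partition_on_cycle_form:
  assumes "distinct w"
  shows "partition_on (set w) (set ` set (cycle_form w))"
proof (rule partition_onI)
  show "\<Union> (set ` set (cycle_form w)) = set w"
    using concat_cycle_form[of w] by (metis set_concat)
  have "distinct (concat (cycle_form w))" using assms by (simp add: concat_cycle_form)
  then show "disjnt p q" if "p \<in> set ` set (cycle_form w)" "q \<in> set ` set (cycle_form w)" "p \<noteq> q"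
    for p q
    using that by (auto simp: distinct_concat_iff disjnt_def)
  show "{} \<notin> set ` set (cycle_form w)"
    using Nil_notin_cycle_form[of w] by auto
qed

text \<open>Surjectivity: write each part decreasingly and concatenate the parts in increasing order
  of their maxima. By \<open>cycle_form_concat\<close>, cutting the resulting word returns these
  blocks.\<close>

lemma ex_decreasing_cycle_form:
  assumes P: "partition_on A P" and "finite A"
  shows "\<exists>w. w \<in> permutations_of_set A \<and> (\<forall>c\<in>set (cycle_form w). sorted_wrt (>) c)
           \<and> set ` set (cycle_form w) = P"
proof -
  have "finite P" using assms by (rule finite_elements[rotated])
  then obtain Bs where Bs: "set Bs = P" "distinct Bs" using finite_distinct_list by blast
  define Cs where "Cs = sort_key Max Bs"
  have Cs: "set Cs = P" "distinct Cs" "sorted (map Max Cs)" using Bs by (auto simp: Cs_def)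
  have block: "finite B" "B \<noteq> {}" if "B \<in> P" for B
    using that assms by (auto simp: partition_on_def intro: finite_subset)
  have disj: "B \<inter> B' = {}" if "B \<in> P" "B' \<in> P" "B \<noteq> B'" for B B'
    using that P by (auto simp: partition_on_def disjoint_def)
  \<comment> \<open>Disjoint parts have different maxima, so the weak order produced by
    \<open>sort_key\<close> is strict, as \<open>max_headed\<close> demands.\<close>
  have inj: "inj_on Max P"
  proof (rule inj_onI)
    fix B B' assume "B \<in> P" "B' \<in> P" "Max B = Max B'"
    then have "Max B \<in> B \<inter> B'" using block Max_in by (metis IntI)
    then show "B = B'" using disj \<open>B \<in> P\<close> \<open>B' \<in> P\<close> by auto
  qed
  let ?L = "\<lambda>B. rev (sorted_list_of_set B)"
  have set_L: "set (?L B) = B" if "B \<in> P" for B using that block by simp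
  have "sorted_wrt (<) (map Max Cs)"
    unfolding strict_sorted_iff using Cs inj by (simp add: distinct_map)
  then have "sorted_wrt (\<lambda>B B'. Max B < Max B') Cs" by (simp add: sorted_wrt_map)
  then have "sorted_wrt (\<lambda>B B'. hd (?L B) < hd (?L B')) Cs"
    by (rule sorted_wrt_mono_rel[rotated]) (use Cs block hd_rev_sorted_list_of_set in metis)
  then have "max_headed (map ?L Cs)"
    using Cs block by (auto simp: max_headed_def sorted_wrt_map hd_rev_sorted_list_of_set)
  then have cf: "cycle_form (concat (map ?L Cs)) = map ?L Cs" by (rule cycle_form_concat)
  have "distinct (concat (map ?L Cs))"
  proof (rule distinct_concat)
    show "distinct (map ?L Cs)"
      unfolding distinct_map using Cs set_L by (auto intro!: inj_on_inverseI[where g = set])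
    show "distinct b" if "b \<in> set (map ?L Cs)" for b
      using that by auto
    show "set b \<inter> set b' = {}" if "b \<in> set (map ?L Cs)" "b' \<in> set (map ?L Cs)" "b \<noteq> b'"
      for b b'
    proof -
      obtain B B' where B: "b = ?L B" "B \<in> P" "b' = ?L B'" "B' \<in> P"
        using \<open>b \<in> set (map ?L Cs)\<close> \<open>b' \<in> set (map ?L Cs)\<close> Cs(1) by auto
      then show ?thesis using \<open>b \<noteq> b'\<close> disj[of B B'] set_L by metis
    qed
  qed
  moreover have "set (concat (map ?L Cs)) = A"
    using Cs set_L P by (auto simp: partition_on_def)
  moreover have "set ` set (map ?L Cs) = P"
    using Cs(1) set_L by (simp add: image_image del: set_rev)
  moreover have "\<forall>c\<in>set (map ?L Cs). sorted_wrt (>) c" by (auto simp: sorted_wrt_rev)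
  ultimately show ?thesis
    unfolding permutations_of_set_def using cf
    by (intro exI[of _ "concat (map ?L Cs)"]) (simp only: mem_Collect_eq simp_thms)
qed

theorem theorem6p1:
  fixes n :: nat
  assumes "n \<ge> 1"
  shows "card (avoiders n ([3, 2], {(1, 2)})) = bell_number n"
proof -
  let ?D = "{w \<in> permutations_of_set {1..n}. \<forall>c\<in>set (cycle_form w). sorted_wrt (>) c}"
  let ?L = "\<lambda>B. rev (sorted_list_of_set B)"
  let ?f = "\<lambda>w. set ` set (cycle_form w)"
  have "avoiders n ([3, 2], {(1, 2)}) = ?D"
  proof (unfold avoiders_def, rule Collect_cong, rule conj_cong[OF refl])
    fix w assume "w \<in> permutations_of_set {1..n}"
    note iff = contains_32_arrow_12_iff_block[OF this]
    show "\<not> contains w ([3, 2], {(1, 2)}) \<longleftrightarrow> (\<forall>c\<in>set (cycle_form w). sorted_wrt (>) c)"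
      unfolding iff by simp
  qed
  moreover have "bij_betw ?f ?D {P. partition_on {1..n} P}"
  proof (rule bij_betw_imageI)
    show "inj_on ?f ?D"
    proof (rule inj_onI)
      \<comment> \<open>Two losses must be undone: \<open>?L\<close> recovers each decreasing block
        from its set, and \<open>max_headed_eqI\<close> recovers the order of the blocks.
        Concatenation then returns the word.\<close>
      fix v w assume vw: "v \<in> ?D" "w \<in> ?D" "?f v = ?f w"
      have blocks: "?L ` ?f u = set (cycle_form u)" if "u \<in> ?D" for u
      proof -
        have "rev (sorted_list_of_set (set c)) = c" if "c \<in> set (cycle_form u)" for c
          using that \<open>u \<in> ?D\<close> sorted_wrt_greater_eq_rev_sorted_list[of c] by auto
        then show ?thesis by (simp add: image_image)
      qed
      have "set (cycle_form v) = set (cycle_form w)"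
        using arg_cong[OF vw(3), of "(`) ?L"] by (simp only: blocks[OF vw(1)] blocks[OF vw(2)])
      then have "cycle_form v = cycle_form w"
        by (intro max_headed_eqI max_headed_cycle_form)
      then show "v = w" by (metis concat_cycle_form)
    qed
    show "?f ` ?D = {P. partition_on {1..n} P}"
    proof (intro equalityI subsetI)
      fix P assume "P \<in> ?f ` ?D"
      then obtain w where "w \<in> permutations_of_set {1..n}" "P = ?f w" by blast
      then show "P \<in> {P. partition_on {1..n} P}"
        using partition_on_cycle_form[of w] by (auto simp: permutations_of_set_def)
    next
      fix P assume "P \<in> {P. partition_on {1..n} P}"
      then obtain w where "w \<in> ?D" "?f w = P"
        using ex_decreasing_cycle_form[of "{1..n}" P] by blast
      then show "P \<in> ?f ` ?D" by (intro image_eqI[of _ _ w]) (rule sym)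
    qed
  qed
  ultimately show ?thesis by (simp add: bell_number_def bij_betw_same_card)
qed

end
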